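(* For each $n\ge 1$ let $(X_{ij})_{1\le i,j\le n}$ be i.i.d. standard Gaussian random variables, let $\mathcal{S}_n$ be the group of permutations of $\{1,\dots,n\}$, and let $\{S(\pi),\ \pi\in\mathcal{S}_n\}$ be the Gaussian process given by \[ S(\pi)=\sum_{i=1}^{n} X_{i\pi(i)},\qquad \pi\in\mathcal{S}_n . \] Then \[ \lim_{n\to\infty}\frac{\mathbb{E}\max_{\pi\in\mathcal{S}_n}S(\pi)}{n\sqrt{2\log n}}=1 . \]
   Context: Here $\log$ is the natural logarithm, and the dependence of $X_{ij}$ and $S$ on $n$ is suppressed from the notation. *)

theory Defs
  imports "HOL-Probability.Probability" "HOL-Combinatorics.Permutations"
begin

definition perm_sum :: "(nat \<Rightarrow> nat \<Rightarrow> 'a \<Rightarrow> real) \<Rightarrow> nat \<Rightarrow> (nat \<Rightarrow> nat) \<Rightarrow> 'a \<Rightarrow> real" where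
  "perm_sum X n \<pi> \<omega> = (\<Sum>i = 1..n. X i (\<pi> i) \<omega>)"

definition iid_std_gaussian_array :: "'a measure \<Rightarrow> nat \<Rightarrow> (nat \<Rightarrow> nat \<Rightarrow> 'a \<Rightarrow> real) \<Rightarrow> bool" where
  "iid_std_gaussian_array M n X \<longleftrightarrow>
     prob_space.indep_vars M (\<lambda>_. borel) (\<lambda>(i, j). X i j) ({1..n} \<times> {1..n}) \<and>
     (\<forall>i\<in>{1..n}. \<forall>j\<in>{1..n}. distributed M lborel (X i j) std_normal_density)"

end

theory Submission
  imports Defs "HOL-Real_Asymp.Real_Asymp"
begin

text \<open>
  Upper bound: the maximum over permutations is at most the sum of the row maxima, and
  \<open>u \<le> c - 1 + exp (u - c)\<close> applied to \<open>l\<close> times a row maximum bounds its expectation by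
  \<open>sqrt (2 * ln n)\<close>.

  Lower bound: choose the columns greedily, row by row. The position of the maximum of one row is
  independent of the other rows, so each row with \<open>k\<close> columns still available contributes the
  expected maximum of \<open>k\<close> independent standard Gaussians. For all \<open>k \<ge> n / ln n\<close> this is
  at least \<open>(1 - o(1)) * sqrt (2 * ln n)\<close>, by a tail estimate at the threshold
  \<open>t = sqrt (2 * (ln n - 2 * ln (ln n))) - 1\<close>, for which \<open>exp (- (t + 1)\<^sup>2 / 2) = (ln n)\<^sup>2 / n\<close>.
\<close>

section \<open>Gaussian estimates: exponential moments, tails and expected maxima\<close>

text \<open>Completing the square: exponential tilting by \<open>l\<close> moves the mean to
  \<open>l\<close>, so the moment generating function is read off from the total mass of a shifted
  normal density.\<close>

lemma std_normal_shift_exp: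
  "std_normal_density x * exp (l * x) = exp (l\<^sup>2 / 2) * normal_density l 1 x"
  by (simp add: normal_density_def field_simps power2_eq_square flip: exp_add)

lemma std_normal_density_antimono:
  assumes "0 \<le> x" "x \<le> y"
  shows "std_normal_density y \<le> std_normal_density x"
proof -
  have "x\<^sup>2 \<le> y\<^sup>2" using assms by (intro power_mono) auto
  then show ?thesis by (simp add: std_normal_density_def divide_right_mono)
qed

context prob_space
begin

lemma std_normal_integrable:
  assumes "distributed M lborel Y std_normal_density"
  shows "integrable M Y"
  using distributed_integrable_var[OF assms] integrable_std_normal_moment[of 1] by simp

lemma std_normal_expectation_exp:
  assumes "distributed M lborel Y std_normal_density"
  shows "integrable M (\<lambda>w. exp (l * Y w))" "expectation (\<lambda>w. exp (l * Y w)) = exp (l\<^sup>2 / 2)"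
proof -
  show "integrable M (\<lambda>w. exp (l * Y w))"
    by (subst distributed_integrable[OF assms, symmetric]) (auto simp: std_normal_shift_exp)
  show "expectation (\<lambda>w. exp (l * Y w)) = exp (l\<^sup>2 / 2)"
    by (subst distributed_integral[OF assms, symmetric]) (auto simp: std_normal_shift_exp)
qed

lemma std_normal_expectation_abs_le:
  assumes "distributed M lborel Y std_normal_density"
  shows "expectation (\<lambda>w. \<bar>Y w\<bar>) \<le> 1"
proof -
  have "expectation (\<lambda>w. \<bar>Y w\<bar>) = sqrt (2 / pi)"
    using distributed_integral[OF assms, of "\<lambda>x. \<bar>x\<bar>"] integral_std_normal_moment_abs_odd[of 0]
    by simp
  also have "\<dots> \<le> 1" using pi_gt3 by simp
  finally show ?thesis .
qed

text \<open>Only the unit interval from \<open>t\<close> to \<open>t + 1\<close> is kept, and there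
  the density is at least its value at the right end. This crude bound is the source of the
  \<open>t + 1\<close> in all later estimates.\<close>

lemma std_normal_tail_ge:
  assumes "distributed M lborel Y std_normal_density" "0 \<le> t"
  shows "std_normal_density (t + 1) \<le> prob (Y -` {t..} \<inter> space M)"
proof -
  have "ennreal (std_normal_density (t + 1)) =
      (\<integral>\<^sup>+x. ennreal (std_normal_density (t + 1)) * indicator {t..t+1} x \<partial>lborel)"
    by (subst nn_integral_cmult_indicator) auto
  also have "\<dots> \<le> (\<integral>\<^sup>+x. ennreal (std_normal_density x) * indicator {t..} x \<partial>lborel)"
    using assms(2)
    by (intro nn_integral_mono)
       (auto simp: indicator_def intro!: ennreal_leI std_normal_density_antimono)
  also have "\<dots> = emeasure M (Y -` {t..} \<inter> space M)"
    by (rule distributed_emeasure[OF assms(1), symmetric]) simp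
  finally show ?thesis
    by (simp add: emeasure_eq_measure)
qed

text \<open>The exponential moment method, with the tangent inequality for \<open>exp\<close> at 0
  in place of Jensen's inequality. The parameter \<open>l\<close> is left free for later
  optimisation.\<close>

lemma std_normal_expectation_Max_le:
  assumes K: "finite K" "K \<noteq> {}"
    and Y: "\<And>i. i \<in> K \<Longrightarrow> distributed M lborel (Y i) std_normal_density"
    and l: "0 < l"
  shows "l * expectation (\<lambda>w. MAX i\<in>K. Y i w) \<le> ln (card K) + l\<^sup>2 / 2"
proof -
  \<comment> \<open>\<open>exp c\<close> is the expected sum of the exponentials, so after
    normalisation that sum contributes exactly 1 and cancels the \<open>- 1\<close> of the tangent
    bound.\<close>
  define c where "c = ln (card K) + l\<^sup>2 / 2"
  have card: "real (card K) > 0" using K by (simp add: card_gt_0_iff)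
  have pw: "l * (MAX i\<in>K. Y i w) \<le> c - 1 + exp (-c) * (\<Sum>i\<in>K. exp (l * Y i w))" for w
  proof -
    have "(MAX i\<in>K. Y i w) \<in> (\<lambda>i. Y i w) ` K"
      using K by (intro Max_in) auto
    then obtain i where i: "i \<in> K" "(MAX i\<in>K. Y i w) = Y i w" by blast
    have "1 + (l * Y i w - c) \<le> exp (l * Y i w - c)" by (rule exp_ge_add_one_self)
    also have "\<dots> = exp (-c) * exp (l * Y i w)" by (simp flip: exp_add)
    also have "\<dots> \<le> exp (-c) * (\<Sum>i\<in>K. exp (l * Y i w))"
      using K(1) i(1) by (intro mult_left_mono member_le_sum) auto
    finally show ?thesis using i(2) by simp
  qed
  have int: "integrable M (\<lambda>w. MAX i\<in>K. Y i w)"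
    using K Y by (intro integrable_MAX std_normal_integrable)
  have "l * expectation (\<lambda>w. MAX i\<in>K. Y i w) = expectation (\<lambda>w. l * (MAX i\<in>K. Y i w))"
    by simp
  also have "\<dots> \<le> expectation (\<lambda>w. c - 1 + exp (-c) * (\<Sum>i\<in>K. exp (l * Y i w)))"
    using int K Y
    by (intro integral_mono pw Bochner_Integration.integrable_add integrable_mult_right
        Bochner_Integration.integrable_sum std_normal_expectation_exp) auto
  also have "\<dots> = c - 1 + exp (-c) * (\<Sum>i\<in>K. expectation (\<lambda>w. exp (l * Y i w)))"
    using K Y std_normal_expectation_exp(1)
    by (subst Bochner_Integration.integral_add) (auto simp: prob_space)
  also have "(\<Sum>i\<in>K. expectation (\<lambda>w. exp (l * Y i w))) = card K * exp (l\<^sup>2 / 2)"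
    using Y by (simp add: std_normal_expectation_exp(2))
  also have "\<dots> = exp c" using card by (simp add: c_def exp_add)
  also have "c - 1 + exp (-c) * exp c = c" by (simp flip: exp_add)
  finally show ?thesis by (simp add: c_def)
qed

text \<open>Off the event \<open>A\<close> that all variables stay below \<open>t\<close>, the
  maximum is at least \<open>t\<close>; on \<open>A\<close> it is still at least one fixed
  \<open>Y k\<close>. Subtracting the absolute value of \<open>Y k\<close> everywhere covers both
  cases and costs at most 1 in expectation. Independence makes \<open>prob A\<close> a product of
  factors at most \<open>1 - q\<close>, hence at most \<open>exp (- q)\<close>.\<close>

lemma std_normal_expectation_Max_ge:
  assumes indep: "indep_vars (\<lambda>_. borel) Y K"
    and K: "finite K" "K \<noteq> {}"
    and Y: "\<And>i. i \<in> K \<Longrightarrow> distributed M lborel (Y i) std_normal_density"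
    and t: "0 \<le> t"
  shows "t * (1 - exp (- (card K * std_normal_density (t + 1)))) - 1
           \<le> expectation (\<lambda>w. MAX i\<in>K. Y i w)"
proof -
  define q where "q = std_normal_density (t + 1)"
  obtain k where k: "k \<in> K" using K by auto
  have meas[measurable]: "Y i \<in> borel_measurable M" if "i \<in> K" for i
    using distributed_measurable[OF Y[OF that]] by simp
  define A where "A = (\<Inter>i\<in>K. Y i -` {..<t} \<inter> space M)"
  have A[measurable]: "A \<in> sets M"
    unfolding A_def using K by (intro sets.finite_INT) auto
  have "prob A = (\<Prod>i\<in>K. prob (Y i -` {..<t} \<inter> space M))"
    unfolding A_def using indep K by (intro indep_varsD_finite) auto
  also have "\<dots> \<le> (\<Prod>i\<in>K. exp (- q))"
  proof (intro prod_mono conjI measure_nonneg)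
    fix i assume i: "i \<in> K"
    have "prob (Y i -` {..<t} \<inter> space M) = prob (space M - (Y i -` {t..} \<inter> space M))"
      by (intro arg_cong[where f = prob]) auto
    also have "\<dots> = 1 - prob (Y i -` {t..} \<inter> space M)"
      using i by (intro prob_compl) auto
    also have "\<dots> \<le> 1 - q" using std_normal_tail_ge[OF Y[OF i] t] by (simp add: q_def)
    also have "\<dots> \<le> exp (- q)" using exp_ge_add_one_self[of "-q"] by simp
    finally show "prob (Y i -` {..<t} \<inter> space M) \<le> exp (- q)" .
  qed
  also have "\<dots> = exp (- (card K * q))" by (simp flip: exp_of_nat_mult)
  finally have prob: "prob A \<le> exp (- (card K * q))" .
  have pw: "t * indicator (space M - A) w - \<bar>Y k w\<bar> \<le> (MAX i\<in>K. Y i w)" if w: "w \<in> space M" for w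
  proof (cases "w \<in> A")
    case True
    have "Y k w \<le> (MAX i\<in>K. Y i w)" using K k by (intro Max_ge) auto
    then show ?thesis using True by simp
  next
    case False
    then obtain i where "i \<in> K" "w \<notin> Y i -` {..<t} \<inter> space M"
      unfolding A_def by blast
    then have i: "i \<in> K" "t \<le> Y i w" using w by auto
    have "Y i w \<le> (MAX i\<in>K. Y i w)" using K i by (intro Max_ge) auto
    then show ?thesis using False w i by simp
  qed
  have int_k: "integrable M (Y k)" by (rule std_normal_integrable[OF Y[OF k]])
  have "t * (1 - exp (- (card K * q))) - 1 \<le> t * (1 - prob A) - expectation (\<lambda>w. \<bar>Y k w\<bar>)"
    using prob t std_normal_expectation_abs_le[OF Y[OF k]]
    by (intro diff_mono mult_left_mono) auto
  also have "\<dots> = t * prob (space M - A) - expectation (\<lambda>w. \<bar>Y k w\<bar>)"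
    by (simp add: prob_compl)
  also have "\<dots> = expectation (\<lambda>w. t * indicator (space M - A) w - \<bar>Y k w\<bar>)"
    using int_k by (subst Bochner_Integration.integral_diff) (auto simp: emeasure_eq_measure)
  also have "\<dots> \<le> expectation (\<lambda>w. MAX i\<in>K. Y i w)"
  proof (intro integral_mono pw)
    show "integrable M (\<lambda>w. t * indicator (space M - A) w - \<bar>Y k w\<bar>)"
      using int_k by (auto simp: emeasure_eq_measure)
    show "integrable M (\<lambda>w. MAX i\<in>K. Y i w)"
      using K Y by (intro integrable_MAX std_normal_integrable)
  qed
  finally show ?thesis by (simp add: q_def)
qed

end

section \<open>Injective assignments of rows to columns and their maximal weight\<close>

text \<open>Injections between separate index sets, rather than permutations, allow one row and an
  arbitrary column to be deleted in an induction; extensionality keeps the set finite.\<close>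

definition assignments :: "'r set \<Rightarrow> 'c set \<Rightarrow> ('r \<Rightarrow> 'c) set" where
  "assignments R C = {f \<in> R \<rightarrow>\<^sub>E C. inj_on f R}"

text \<open>The array is a function on pairs, so that this is a random variable on a product space
  and independence of blocks of entries applies to it.\<close>

definition max_assignment :: "'r set \<Rightarrow> 'c set \<Rightarrow> ('r \<times> 'c \<Rightarrow> real) \<Rightarrow> real" where
  "max_assignment R C x = (MAX f\<in>assignments R C. \<Sum>i\<in>R. x (i, f i))"

lemma finite_assignments:
  assumes "finite R" "finite C"
  shows "finite (assignments R C)"
  unfolding assignments_def using finite_PiE[OF assms(1), of "\<lambda>_. C"] assms(2) by auto

lemma assignments_fun_upd:
  assumes "r \<notin> R" "j \<in> C" "f \<in> assignments R (C - {j})"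
  shows "f(r := j) \<in> assignments (insert r R) C"
  using assms by (force simp: assignments_def inj_on_def PiE_iff extensional_def)

lemma assignments_nonempty:
  assumes "finite R" "finite C" "card R \<le> card C"
  shows "assignments R C \<noteq> {}"
proof -
  obtain f where f: "f ` R \<subseteq> C" "inj_on f R"
    using card_le_inj[OF assms] by auto
  then have "restrict f R \<in> assignments R C"
    by (auto simp: assignments_def inj_on_def)
  then show ?thesis by auto
qed

text \<open>One greedy step: commit row \<open>r\<close> to column \<open>j\<close> and extend an
  optimal assignment of the remaining rows to the remaining columns.\<close>

lemma max_assignment_insert_ge:
  assumes "finite R" "finite C" "r \<notin> R" "j \<in> C" "card R < card C"
  shows "x (r, j) + max_assignment R (C - {j}) x \<le> max_assignment (insert r R) C x"
proof -
  let ?s = "\<lambda>R f. \<Sum>i\<in>R. x (i, f i)"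
  have "assignments R (C - {j}) \<noteq> {}"
    using assms by (intro assignments_nonempty) auto
  then have "max_assignment R (C - {j}) x \<in> ?s R ` assignments R (C - {j})"
    unfolding max_assignment_def using assms by (intro Max_in) (auto simp: finite_assignments)
  then obtain f where f: "f \<in> assignments R (C - {j})" "max_assignment R (C - {j}) x = ?s R f"
    by blast
  have "?s R (f(r := j)) = ?s R f"
    using assms(3) by (intro sum.cong) auto
  then have "x (r, j) + max_assignment R (C - {j}) x = ?s (insert r R) (f(r := j))"
    using assms f by simp
  also have "\<dots> \<le> max_assignment (insert r R) C x"
    unfolding max_assignment_def using assms
    by (intro Max_ge imageI finite_imageI finite_assignments assignments_fun_upd f(1)) auto
  finally show ?thesis .
qed

lemma max_assignment_restrict:
  assumes "R \<times> C \<subseteq> A"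
  shows "max_assignment R C (restrict x A) = max_assignment R C x"
  unfolding max_assignment_def using assms
  by (intro arg_cong[where f = Max] image_cong sum.cong refl) (auto simp: assignments_def PiE_iff)

lemma measurable_max_assignment:
  assumes "finite R" "finite C" "R \<times> C \<subseteq> A"
  shows "max_assignment R C \<in> borel_measurable (PiM A (\<lambda>_. borel))"
  unfolding max_assignment_def using assms
  by (intro borel_measurable_Max finite_assignments borel_measurable_sum measurable_component_singleton)
     (auto simp: assignments_def PiE_iff)

lemma integrable_max_assignment:
  assumes "finite R" "finite C" "card R \<le> card C"
    and "\<And>p. p \<in> R \<times> C \<Longrightarrow> integrable M (Z p)"
  shows "integrable M (\<lambda>w. max_assignment R C (\<lambda>p. Z p w))"
  unfolding max_assignment_def using assms
  by (intro integrable_MAX finite_assignments assignments_nonempty Bochner_Integration.integrable_sum)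
     (auto simp: assignments_def PiE_iff)

text \<open>Breaking ties by the order on columns makes the events "the maximum is attained at \<open>j\<close>"
  a partition, without discarding null sets.\<close>

definition first_max :: "'c::linorder set \<Rightarrow> ('c \<Rightarrow> real) \<Rightarrow> 'c \<Rightarrow> bool" where
  "first_max C u j \<longleftrightarrow> (\<forall>c\<in>C. u c \<le> u j \<and> (c < j \<longrightarrow> u c < u j))"

lemma first_max_unique:
  assumes "first_max C u i" "first_max C u j" "i \<in> C" "j \<in> C"
  shows "i = j"
  using assms unfolding first_max_def by (metis linorder_neqE not_le)

lemma measurable_first_max:
  assumes "finite C" "\<And>c. c \<in> insert j C \<Longrightarrow> u c \<in> borel_measurable N"
  shows "Measurable.pred N (\<lambda>x. first_max C (\<lambda>c. u c x) j)"
  unfolding first_max_def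
proof (rule pred_intros_finite(3)[OF assms(1)])
  fix c assume "c \<in> C"
  then have [measurable]: "u c \<in> borel_measurable N" "u j \<in> borel_measurable N"
    using assms(2) by auto
  show "Measurable.pred N (\<lambda>x. u c x \<le> u j x \<and> (c < j \<longrightarrow> u c x < u j x))"
    by measurable
qed

text \<open>The least of the finitely many maximisers is the only \<open>first_max\<close>, so one
  term of the sum survives. This turns a choice of random column into a finite sum over
  deterministic columns.\<close>

lemma sum_first_max:
  assumes "finite C" "C \<noteq> {}"
  obtains j where "j \<in> C" "u j = (MAX c\<in>C. u c)"
    "\<And>g :: _ \<Rightarrow> real. (\<Sum>c\<in>C. of_bool (first_max C u c) * g c) = g j"
proof -
  define D where "D = {c \<in> C. u c = (MAX c\<in>C. u c)}"
  have "(MAX c\<in>C. u c) \<in> u ` C" using assms by (intro Max_in) auto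
  then obtain i where "i \<in> C" "u i = (MAX c\<in>C. u c)" by (metis imageE)
  then have "i \<in> D" by (simp add: D_def)
  then have D: "finite D" "D \<noteq> {}" using assms by (auto simp: D_def)
  define j where "j = Min D"
  have j: "j \<in> C" "u j = (MAX c\<in>C. u c)" using Min_in[OF D] by (auto simp: D_def j_def)
  have le: "u c \<le> u j" if "c \<in> C" for c using assms that unfolding j(2) by (intro Max_ge) auto
  have "u c < u j" if "c \<in> C" "c < j" for c
  proof (rule ccontr)
    assume "\<not> u c < u j"
    then have "c \<in> D" using le[OF that(1)] that(1) j(2) by (auto simp: D_def)
    then show False using Min_le[OF D(1), of c] that(2) by (simp add: j_def)
  qed
  then have fm: "first_max C u j" using le by (auto simp: first_max_def)
  have iff: "first_max C u c \<longleftrightarrow> c = j" if "c \<in> C" for c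
    using first_max_unique[OF _ fm that j(1)] fm by blast
  have "(\<Sum>c\<in>C. of_bool (first_max C u c) * g c) = g j" for g :: "_ \<Rightarrow> real"
  proof -
    have "(\<Sum>c\<in>C. of_bool (first_max C u c) * g c) = (\<Sum>c\<in>C. if c = j then g c else 0)"
      by (intro sum.cong) (auto simp: iff)
    then show ?thesis using assms(1) j(1) by simp
  qed
  then show ?thesis using that j by blast
qed

section \<open>The greedy lower bound for the expected maximal assignment\<close>

context prob_space
begin

text \<open>Induction on the rows. Row \<open>r\<close> takes its first maximiser, which contributes
  at least \<open>L (card C)\<close>. The indicator of column \<open>j\<close> being chosen depends
  on row \<open>r\<close> alone, and the best continuation without \<open>j\<close> on the other
  rows, so the expectation of their product factors. The inductive bound on the continuation is the
  same for every \<open>j\<close>, and the indicators sum to 1.\<close>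

lemma expectation_max_assignment_ge:
  fixes Z :: "'r \<times> 'c::linorder \<Rightarrow> 'a \<Rightarrow> real"
  assumes indep: "indep_vars (\<lambda>_. borel) Z I"
    and int: "\<And>p. p \<in> I \<Longrightarrow> integrable M (Z p)"
    and row: "\<And>r C. finite C \<Longrightarrow> C \<noteq> {} \<Longrightarrow> {r} \<times> C \<subseteq> I \<Longrightarrow>
                L (card C) \<le> expectation (\<lambda>w. MAX j\<in>C. Z (r, j) w)"
    and "finite R" "finite C" "card R = card C" "R \<times> C \<subseteq> I"
  shows "(\<Sum>k=1..card R. L k) \<le> expectation (\<lambda>w. max_assignment R C (\<lambda>p. Z p w))"
  using assms(4-)
proof (induction R arbitrary: C rule: finite_induct)
  case empty
  then show ?case by (simp add: max_assignment_def assignments_def)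
next
  case (insert r R)
  let ?E = "max_assignment (insert r R) C"
  have card: "card C = Suc (card R)" and C: "C \<noteq> {}" using insert by auto
  define h where "h j w = (of_bool (first_max C (\<lambda>c. Z (r, c) w) j) :: real)" for j w
  define g where "g j w = max_assignment R (C - {j}) (\<lambda>p. Z p w)" for j w
  \<comment> \<open>\<open>h j\<close> and \<open>g j\<close> are measurable functions of two
    disjoint blocks of entries, row \<open>r\<close> and the rows in \<open>R\<close>.\<close>
  have indep_hg: "indep_var borel (h j) borel (g j)" if j: "j \<in> C" for j
  proof -
    let ?A = "{r} \<times> C" and ?B = "R \<times> C"
    have "indep_var (PiM ?A (\<lambda>_. borel)) (\<lambda>w. restrict (\<lambda>p. Z p w) ?A)
            (PiM ?B (\<lambda>_. borel)) (\<lambda>w. restrict (\<lambda>p. Z p w) ?B)"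
      using insert.hyps insert.prems by (intro indep_var_restrict[OF indep]) auto
    moreover have "(\<lambda>x. of_bool (first_max C (\<lambda>c. x (r, c)) j) :: real)
        \<in> borel_measurable (PiM ?A (\<lambda>_. borel))"
    proof -
      have component: "(\<lambda>x. x (r, c)) \<in> borel_measurable (PiM ?A (\<lambda>_. borel :: real measure))"
        if "c \<in> C" for c using that by (intro measurable_component_singleton) auto
      then have "Measurable.pred (PiM ?A (\<lambda>_. borel)) (\<lambda>x. first_max C (\<lambda>c. x (r, c)) j)"
        using insert.prems(1) j by (intro measurable_first_max) auto
      then show ?thesis by (simp add: of_bool_def)
    qed
    moreover have "max_assignment R (C - {j}) \<in> borel_measurable (PiM ?B (\<lambda>_. borel))"
      using insert by (intro measurable_max_assignment) auto
    ultimately have "indep_var borel ((\<lambda>x. of_bool (first_max C (\<lambda>c. x (r, c)) j)) \<circ> (\<lambda>w. restrict (\<lambda>p. Z p w) ?A))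
        borel (max_assignment R (C - {j}) \<circ> (\<lambda>w. restrict (\<lambda>p. Z p w) ?B))"
      by (rule indep_var_compose)
    also have "((\<lambda>x. of_bool (first_max C (\<lambda>c. x (r, c)) j)) \<circ> (\<lambda>w. restrict (\<lambda>p. Z p w) ?A)) = h j"
      using j by (auto simp: h_def first_max_def fun_eq_iff)
    also have "max_assignment R (C - {j}) \<circ> (\<lambda>w. restrict (\<lambda>p. Z p w) ?B) = g j"
      by (auto simp: g_def fun_eq_iff intro!: max_assignment_restrict)
    finally show ?thesis .
  qed
  have int_h: "integrable M (h j)" if "j \<in> C" for j
    using indep_var_rv1[OF indep_hg[OF that]]
    by (intro integrable_const_bound[where B = 1]) (auto simp: h_def)
  have int_g: "integrable M (g j)" if "j \<in> C" for j
    unfolding g_def using insert.hyps insert.prems that card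
    by (intro integrable_max_assignment int) auto
  have int_hg: "integrable M (\<lambda>w. h j w * g j w)" if "j \<in> C" for j
    using that by (intro indep_var_integrable indep_hg int_h int_g)
  have int_row: "integrable M (\<lambda>w. MAX j\<in>C. Z (r, j) w)"
    using insert.prems C by (intro integrable_MAX int) auto
  have pw: "(MAX j\<in>C. Z (r, j) w) + (\<Sum>j\<in>C. h j w * g j w) \<le> ?E (\<lambda>p. Z p w)"
    and h1: "(\<Sum>j\<in>C. h j w) = 1" for w
  proof -
    obtain j where j: "j \<in> C" "Z (r, j) w = (MAX c\<in>C. Z (r, c) w)"
      and s: "\<And>g :: _ \<Rightarrow> real. (\<Sum>c\<in>C. h c w * g c) = g j"
      unfolding h_def using sum_first_max[OF insert.prems(1) C, of "\<lambda>c. Z (r, c) w"] by blast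
    show "(\<Sum>j\<in>C. h j w) = 1" using s[of "\<lambda>_. 1"] by simp
    show "(MAX j\<in>C. Z (r, j) w) + (\<Sum>j\<in>C. h j w * g j w) \<le> ?E (\<lambda>p. Z p w)"
      using max_assignment_insert_ge[of R C r j "\<lambda>p. Z p w"] j insert card
      unfolding s[of "\<lambda>c. g c w"] by (simp add: g_def)
  qed
  have "(\<Sum>k=1..card (insert r R). L k) = L (card C) + (\<Sum>k=1..card R. L k)"
    using insert card by simp
  \<comment> \<open>Inserting a factor of total mass 1 distributes the inductive bound over the
    possible columns, where each copy can be compared with its own \<open>g j\<close>.\<close>
  also have "(\<Sum>k=1..card R. L k) = expectation (\<lambda>w. \<Sum>j\<in>C. h j w) * (\<Sum>k=1..card R. L k)"
    by (simp add: h1 prob_space)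
  also have "\<dots> = (\<Sum>j\<in>C. expectation (h j) * (\<Sum>k=1..card R. L k))"
    using int_h by (simp add: sum_distrib_right)
  also have "\<dots> \<le> (\<Sum>j\<in>C. expectation (h j) * expectation (g j))"
  proof (intro sum_mono mult_left_mono)
    fix j assume "j \<in> C"
    then show "(\<Sum>k=1..card R. L k) \<le> expectation (g j)"
      unfolding g_def using insert.prems insert.hyps card by (intro insert.IH) auto
  qed (auto simp: h_def)
  also have "\<dots> = (\<Sum>j\<in>C. expectation (\<lambda>w. h j w * g j w))"
    using indep_hg int_h int_g by (intro sum.cong refl indep_var_lebesgue_integral[symmetric]) auto
  also have "\<dots> = expectation (\<lambda>w. \<Sum>j\<in>C. h j w * g j w)"
    using int_hg by simp
  also have "L (card C) \<le> expectation (\<lambda>w. MAX j\<in>C. Z (r, j) w)"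
    using insert.prems C by (intro row) auto
  also have "expectation (\<lambda>w. MAX j\<in>C. Z (r, j) w) + expectation (\<lambda>w. \<Sum>j\<in>C. h j w * g j w)
      = expectation (\<lambda>w. (MAX j\<in>C. Z (r, j) w) + (\<Sum>j\<in>C. h j w * g j w))"
    using int_row int_hg by (intro Bochner_Integration.integral_add[symmetric]) auto
  also have "\<dots> \<le> expectation (\<lambda>w. ?E (\<lambda>p. Z p w))"
    using insert card int_row int_hg
    by (intro integral_mono pw integrable_max_assignment int Bochner_Integration.integrable_add
        Bochner_Integration.integrable_sum) auto
  finally show ?case by simp
qed

end

section \<open>Comparison of permutations with row maxima and with assignments\<close>

lemma Max_perm_sum_le:
  assumes "1 \<le> n"
  shows "(MAX \<pi>\<in>{\<pi>. \<pi> permutes {1..n}}. perm_sum X n \<pi> w) \<le> (\<Sum>i=1..n. MAX j\<in>{1..n}. X i j w)"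
proof (rule Max.boundedI)
  show "finite ((\<lambda>\<pi>. perm_sum X n \<pi> w) ` {\<pi>. \<pi> permutes {1..n}})"
    by (simp add: finite_permutations)
  show "(\<lambda>\<pi>. perm_sum X n \<pi> w) ` {\<pi>. \<pi> permutes {1..n}} \<noteq> {}"
    using permutes_id by blast
next
  fix s assume "s \<in> (\<lambda>\<pi>. perm_sum X n \<pi> w) ` {\<pi>. \<pi> permutes {1..n}}"
  then obtain p where p: "p permutes {1..n}" "s = (\<Sum>i=1..n. X i (p i) w)"
    by (auto simp: perm_sum_def)
  show "s \<le> (\<Sum>i=1..n. MAX j\<in>{1..n}. X i j w)"
    unfolding p(2)
  proof (intro sum_mono Max_ge)
    fix i assume "i \<in> {1..n}"
    then have "p i \<in> {1..n}" using permutes_in_image[OF p(1)] by simp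
    then show "X i (p i) w \<in> (\<lambda>j. X i j w) ` {1..n}" by blast
  qed simp
qed

lemma max_assignment_le_Max_perm_sum:
  "max_assignment {1..n} {1..n} (\<lambda>p. (\<lambda>(i, j). X i j) p w)
     \<le> (MAX \<pi>\<in>{\<pi>. \<pi> permutes {1..n}}. perm_sum X n \<pi> w)"
  unfolding max_assignment_def
proof (rule Max.boundedI)
  let ?s = "\<lambda>f. \<Sum>i\<in>{1..n}. (\<lambda>(i, j). X i j) (i, f i) w"
  show "finite (?s ` assignments {1..n} {1..n})" by (simp add: finite_assignments)
  show "?s ` assignments {1..n} {1..n} \<noteq> {}" by (simp add: assignments_nonempty)
  fix s assume "s \<in> ?s ` assignments {1..n} {1..n}"
  then obtain f where f: "f \<in> assignments {1..n} {1..n}" "s = ?s f" by blast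
  \<comment> \<open>An injective self-map of a finite set is bijective. Extending by the identity is
    required by \<open>permutes\<close>, whereas \<open>f\<close> is \<open>undefined\<close>
    outside the index set.\<close>
  define p where "p i = (if i \<in> {1..n} then f i else i)" for i
  have "inj_on f {1..n}" "f ` {1..n} \<subseteq> {1..n}" using f(1) by (auto simp: assignments_def)
  then have "bij_betw f {1..n} {1..n}"
    using endo_inj_surj[of "{1..n}" f] by (auto simp: bij_betw_def)
  then have "bij_betw p {1..n} {1..n}"
    by (rule bij_betw_cong[THEN iffD1, rotated]) (simp add: p_def)
  then have perm: "p permutes {1..n}" by (rule bij_imp_permutes) (auto simp: p_def)
  have "s = perm_sum X n p w" unfolding f(2) perm_sum_def p_def by (intro sum.cong) auto
  also have "\<dots> \<le> (MAX \<pi>\<in>{\<pi>. \<pi> permutes {1..n}}. perm_sum X n \<pi> w)"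
    using perm by (intro Max_ge) (auto simp: finite_permutations)
  finally show "s \<le> (MAX \<pi>\<in>{\<pi>. \<pi> permutes {1..n}}. perm_sum X n \<pi> w)" .
qed

text \<open>The indices left out are at most the integer part of \<open>a\<close>. This counts the
  greedy steps at which at least \<open>a\<close> columns are still available.\<close>

lemma card_above_ge:
  assumes "0 \<le> a"
  shows "real n - a \<le> card {k \<in> {1..n}. a \<le> real k}"
proof -
  have "k \<le> nat \<lfloor>a\<rfloor>" if "\<not> a \<le> real k" for k
    using that by (intro le_nat_floor) simp
  then have "{1..n} \<subseteq> {k \<in> {1..n}. a \<le> real k} \<union> {1..nat \<lfloor>a\<rfloor>}"
    by fastforce
  then have "card {1..n} \<le> card ({k \<in> {1..n}. a \<le> real k} \<union> {1..nat \<lfloor>a\<rfloor>})"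
    by (intro card_mono) auto
  also have "\<dots> \<le> card {k \<in> {1..n}. a \<le> real k} + nat \<lfloor>a\<rfloor>"
    by (rule order_trans[OF card_Un_le]) simp
  finally have "real n \<le> card {k \<in> {1..n}. a \<le> real k} + real (nat \<lfloor>a\<rfloor>)" by simp
  also have "real (nat \<lfloor>a\<rfloor>) \<le> a" using assms by simp
  finally show ?thesis by simp
qed

section \<open>Non-asymptotic bounds for the expected maximum over permutations\<close>

context prob_space
begin

context
  fixes X :: "nat \<Rightarrow> nat \<Rightarrow> 'a \<Rightarrow> real" and n :: nat
  assumes iid: "iid_std_gaussian_array M n X"
begin

lemma array_std_normal:
  "i \<in> {1..n} \<Longrightarrow> j \<in> {1..n} \<Longrightarrow> distributed M lborel (X i j) std_normal_density"
  using iid by (simp add: iid_std_gaussian_array_def)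

lemma integrable_Max_perm_sum:
  "integrable M (\<lambda>w. MAX \<pi>\<in>{\<pi>. \<pi> permutes {1..n}}. perm_sum X n \<pi> w)"
proof (intro integrable_MAX)
  fix p assume p: "p \<in> {\<pi>. \<pi> permutes {1..n}}"
  have "p i \<in> {1..n}" if "i \<in> {1..n}" for i
    using that p permutes_in_image[of p "{1..n}" i] by simp
  then show "integrable M (perm_sum X n p)"
    unfolding perm_sum_def[abs_def]
    by (intro Bochner_Integration.integrable_sum std_normal_integrable array_std_normal)
next
  show "{\<pi>. \<pi> permutes {1..n}} \<noteq> {}" using permutes_id by blast
qed (simp add: finite_permutations)

lemma expectation_Max_perm_sum_le:
  assumes n: "2 \<le> n"
  shows "expectation (\<lambda>w. MAX \<pi>\<in>{\<pi>. \<pi> permutes {1..n}}. perm_sum X n \<pi> w)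
           \<le> n * sqrt (2 * ln n)"
proof -
  \<comment> \<open>This value minimises \<open>(ln n + l\<^sup>2 / 2) / l\<close>, and the minimum
    is again \<open>l\<close>.\<close>
  define l where "l = sqrt (2 * ln (real n))"
  have l: "0 < l" "l\<^sup>2 = 2 * ln n" using n by (auto simp: l_def)
  have row: "expectation (\<lambda>w. MAX j\<in>{1..n}. X i j w) \<le> l" if "i \<in> {1..n}" for i
  proof -
    have "l * expectation (\<lambda>w. MAX j\<in>{1..n}. X i j w) \<le> ln (card {1..n}) + l\<^sup>2 / 2"
      using n that l(1) by (intro std_normal_expectation_Max_le array_std_normal) auto
    also have "\<dots> = l * l" using l(2) by (simp add: power2_eq_square)
    finally show ?thesis using l(1) by simp
  qed
  have int: "integrable M (\<lambda>w. MAX j\<in>{1..n}. X i j w)" if "i \<in> {1..n}" for i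
    using n that by (intro integrable_MAX std_normal_integrable array_std_normal) auto
  have "expectation (\<lambda>w. MAX \<pi>\<in>{\<pi>. \<pi> permutes {1..n}}. perm_sum X n \<pi> w)
      \<le> expectation (\<lambda>w. \<Sum>i=1..n. MAX j\<in>{1..n}. X i j w)"
    using n by (intro integral_mono integrable_Max_perm_sum Max_perm_sum_le
        Bochner_Integration.integrable_sum int) auto
  also have "\<dots> = (\<Sum>i=1..n. expectation (\<lambda>w. MAX j\<in>{1..n}. X i j w))"
    using int by (intro Bochner_Integration.integral_sum)
  also have "\<dots> \<le> (\<Sum>i=1..n. l)" by (intro sum_mono row)
  finally show ?thesis by (simp add: l_def)
qed

text \<open>Greedy steps with at least \<open>a\<close> free columns contribute at least
  \<open>b\<close> each, and there are at least \<open>n - a\<close> of them; the remaining steps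
  contribute at least 0.\<close>

lemma expectation_Max_perm_sum_ge:
  fixes a b t :: real
  assumes a: "0 \<le> a" and t: "0 \<le> t"
    and b: "b = t * (1 - exp (- (a * std_normal_density (t + 1)))) - 1" "0 \<le> b"
  shows "(n - a) * b \<le> expectation (\<lambda>w. MAX \<pi>\<in>{\<pi>. \<pi> permutes {1..n}}. perm_sum X n \<pi> w)"
proof -
  let ?I = "{1..n} \<times> {1..n}"
  define Z where "Z = (\<lambda>(i, j). X i j)"
  \<comment> \<open>With few columns left, 0 is a valid bound because the maximum dominates a single
    centred variable.\<close>
  define L where "L k = (if a \<le> real k then b else 0)" for k :: nat
  have indep: "indep_vars (\<lambda>_. borel) Z ?I"
    using iid by (simp add: iid_std_gaussian_array_def Z_def)
  have Z: "distributed M lborel (Z p) std_normal_density" if "p \<in> ?I" for p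
    using that array_std_normal by (auto simp: Z_def)
  have row: "L (card C) \<le> expectation (\<lambda>w. MAX j\<in>C. Z (r, j) w)"
    if C: "finite C" "C \<noteq> {}" "{r} \<times> C \<subseteq> ?I" for r C
  proof (cases "a \<le> card C")
    case True
    \<comment> \<open>Indexing the row by pairs lets independence be inherited directly from the
      whole array.\<close>
    have img: "(\<lambda>p. Z p w) ` ({r} \<times> C) = (\<lambda>j. Z (r, j) w) ` C" for w by auto
    have "b \<le> t * (1 - exp (- (card ({r} \<times> C) * std_normal_density (t + 1)))) - 1"
      unfolding b(1) using True t
      by (intro diff_right_mono mult_left_mono diff_left_mono)
         (auto simp: card_cartesian_product intro!: mult_right_mono)
    also have "\<dots> \<le> expectation (\<lambda>w. MAX p\<in>{r} \<times> C. Z p w)"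
      using C t by (intro std_normal_expectation_Max_ge indep_vars_subset[OF indep] Z) auto
    finally show ?thesis using True by (simp add: L_def img)
  next
    case False
    obtain j where j: "j \<in> C" using C by auto
    have "0 = expectation (Z (r, j))"
      using C(3) j by (intro standard_normal_distributed_expectation[symmetric] Z) auto
    also have "\<dots> \<le> expectation (\<lambda>w. MAX j\<in>C. Z (r, j) w)"
      using C j by (intro integral_mono integrable_MAX std_normal_integrable Z Max_ge) auto
    finally show ?thesis using False by (simp add: L_def)
  qed
  have "(n - a) * b \<le> card {k \<in> {1..n}. a \<le> real k} * b"
    using card_above_ge[OF a] b(2) by (intro mult_right_mono) auto
  also have "\<dots> = (\<Sum>k=1..card {1..n}. L k)"
    unfolding L_def by (simp add: sum.If_cases Int_def)
  also have "\<dots> \<le> expectation (\<lambda>w. max_assignment {1..n} {1..n} (\<lambda>p. Z p w))"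
    by (intro expectation_max_assignment_ge[OF indep] row std_normal_integrable Z) auto
  also have "\<dots> \<le> expectation (\<lambda>w. MAX \<pi>\<in>{\<pi>. \<pi> permutes {1..n}}. perm_sum X n \<pi> w)"
    unfolding Z_def
    by (intro integral_mono integrable_max_assignment integrable_Max_perm_sum
        max_assignment_le_Max_perm_sum std_normal_integrable)
       (use Z in \<open>auto simp: Z_def\<close>)
  finally show ?thesis .
qed

end

end

section \<open>Choice of parameters and passage to the limit\<close>

theorem theorem1:
  fixes M :: "nat \<Rightarrow> 'a measure"
    and X :: "nat \<Rightarrow> nat \<Rightarrow> nat \<Rightarrow> 'a \<Rightarrow> real"
  assumes "\<And>n. n \<ge> 1 \<Longrightarrow> prob_space (M n)"
    and "\<And>n. n \<ge> 1 \<Longrightarrow> iid_std_gaussian_array (M n) n (X n)"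
  shows "(\<lambda>n. prob_space.expectation (M n) (\<lambda>\<omega>. MAX \<pi>\<in>{\<pi>. \<pi> permutes {1..n}}. perm_sum (X n) n \<pi> \<omega>)
              / (real n * sqrt (2 * ln (real n)))) \<longlonglongrightarrow> 1"
proof -
  define E where "E n = prob_space.expectation (M n)
      (\<lambda>\<omega>. MAX \<pi>\<in>{\<pi>. \<pi> permutes {1..n}}. perm_sum (X n) n \<pi> \<omega>)" for n
  define t where "t n = sqrt (2 * (ln (real n) - 2 * ln (ln (real n)))) - 1" for n
  define c where "c = 1 / sqrt (2 * pi)"
  \<comment> \<open>This is the row bound for \<open>a = n / ln n\<close>: then \<open>a\<close>
    times the density at \<open>t n + 1\<close> equals \<open>ln n * c\<close>, so the exponential
    is \<open>n\<close> to the power \<open>- c\<close> and vanishes in the limit.\<close>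
  define b where "b n = t n * (1 - exp (- (ln (real n) * c))) - 1" for n
  have c: "0 < c" by (simp add: c_def)
  have upper: "E n / (real n * sqrt (2 * ln (real n))) \<le> 1" if "n \<ge> 2" for n
  proof -
    interpret prob_space "M n" using assms(1) that by simp
    have "E n \<le> n * sqrt (2 * ln n)"
      unfolding E_def using assms(2) that by (intro expectation_Max_perm_sum_le) auto
    then show ?thesis using that by (simp add: divide_le_eq)
  qed
  have lower: "(real n - n / ln n) * b n \<le> E n"
    if n: "n \<ge> 3" and t: "0 \<le> t n" and b: "0 \<le> b n"
      and s: "0 \<le> ln (real n) - 2 * ln (ln (real n))" for n
  proof -
    interpret prob_space "M n" using assms(1) n by simp
    have ln: "0 < ln (real n)" using n by simp
    \<comment> \<open>The \<open>- 1\<close> in \<open>t\<close> cancels the shift, and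
      \<open>s\<close> allows the square to undo the square root.\<close>
    have "std_normal_density (t n + 1) = exp (2 * ln (ln (real n)) - ln (real n)) * c"
      using s by (simp add: t_def std_normal_density_def c_def)
    also have "\<dots> = (ln n)\<^sup>2 / n * c"
      using n ln by (simp add: exp_diff exp_double)
    finally have "n / ln n * std_normal_density (t n + 1) = ln n * c"
      using n ln by (simp add: power2_eq_square field_simps)
    then show ?thesis
      unfolding E_def using assms(2) n t b ln
      by (intro expectation_Max_perm_sum_ge[where a = "n / ln n" and t = "t n"]) (auto simp: b_def)
  qed
  \<comment> \<open>Both corrections are of lower order: a fraction \<open>1 / ln n\<close> of the
    rows is lost, and \<open>ln (ln n)\<close> is negligible against \<open>ln n\<close> inside the
    square root.\<close>
  have lower_lim: "(\<lambda>n. (real n - n / ln n) * b n / (real n * sqrt (2 * ln (real n)))) \<longlonglongrightarrow> 1"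
    unfolding b_def t_def using c by real_asymp
  have "eventually (\<lambda>n. 0 \<le> t n) sequentially"
    unfolding t_def by real_asymp
  moreover have "eventually (\<lambda>n. 0 \<le> b n) sequentially"
    unfolding b_def t_def using c by real_asymp
  moreover have "eventually (\<lambda>n. 0 \<le> ln (real n) - 2 * ln (ln (real n))) sequentially"
    by real_asymp
  ultimately have "eventually (\<lambda>n. (real n - n / ln n) * b n / (real n * sqrt (2 * ln (real n)))
      \<le> E n / (real n * sqrt (2 * ln (real n)))) sequentially"
    using eventually_ge_at_top[of 3] by eventually_elim (intro divide_right_mono lower, auto)
  moreover have "eventually (\<lambda>n. E n / (real n * sqrt (2 * ln (real n))) \<le> 1) sequentially"
    using eventually_ge_at_top[of 2] by eventually_elim (rule upper)
  ultimately show ?thesis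
    unfolding E_def[symmetric]
    by (rule tendsto_sandwich[OF _ _ lower_lim tendsto_const])
qed

end
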